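(* Let $\rho=(\rho_c)_{c\in\mathcal{C}}$ with $\rho_c=\lambda_c/\mu_c$. If $\rho\in\mathrm{int}(\Gamma)$ and $\xi=\eta(\rho)<e$ componentwise, where $e=(1,\dots,1)$, then $x^*\in E^1$ given by $$x^*_{c,n}=(1-\xi_c)\,\xi_c^{\,n},\qquad c\in\mathcal{C},\ n\in\mathbb{N}_0,$$ is the unique fixed point in $E^1$ of the initial-value problem $\frac{dx(t)}{dt}=H(x(t))$, $x(0)=x^\infty$; i.e. $x^*$ is the unique element of $E^1$ with $H(x^* )=0$.
   Context: Let $\mathcal{C}=\{1,\dots,C\}$ and let $G=(\mathcal{C},\mathcal{E})$ be a finite simple graph. $\Omega\subset\{0,1\}^C$ is the set of $\omega$ with $\omega_c\omega_d=0$ whenever $(c,d)\in\mathcal{E}$ (independent sets of $G$); $\Omega_{-c}=\{\omega\in\Omega:\omega_c=0,\ \omega_d=0\ \forall d\text{ with }(c,d)\in\mathcal{E}\}$; $\Omega_{+c}=\{\omega\in\Omega:\omega_c=1\}$. $\Gamma=\mathrm{Conv}(\Omega)\subset\mathbb{R}_+^C$ is the convex hull of $\Omega$. Parameters $\lambda_c,\mu_c,\nu_c,p_c$ ($c\in\mathcal{C}$) are positive with $\sum_c p_c=1$; $\sigma_c=\nu_c/\mu_c$. For $\eta\in\mathbb{R}_+^C$ put $Z(\omega;\eta)=\prod_{c}(\eta_c\sigma_c)^{\omega_c}$ (convention $0^0=1$), $\pi(\omega;\eta)=Z(\omega;\eta)/\sum_{\omega'\in\Omega}Z(\omega';\eta)$,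 and the throughput map $\theta_c(\eta)=\sum_{\omega\in\Omega_{+c}}\pi(\omega;\eta)$. It is known that for every $\gamma\in\mathrm{int}(\Gamma)$ there is a unique vector $\eta(\gamma)\in\mathbb{R}_+^C$ with $\theta(\eta(\gamma))=\gamma$; this defines $\eta(\cdot)$. $E=\chi^C$ with $\chi=\{(x_n)_{n\in\mathbb{N}_0}:x_n\ge0,\sum_n x_n\le1\}$, and $E^1=\{x\in E:\sum_{n\ge0}x_{c,n}=1\ \forall c\}$. With $e_{c,n}$ the unit vector in position $(c,n)$, $$H(x)=\sum_{c\in\mathcal{C}}\frac{1}{p_c}\Big(\lambda_c\sum_{n=0}^{\infty}x_{c,n}(e_{c,n+1}-e_{c,n})+\pi_{x_0}(\Omega_{-c})\nu_c\sum_{n=1}^{\infty}x_{c,n}(e_{c,n-1}-e_{c,n})\Big),$$ where $x_0=(x_{1,0},\dots,x_{C,0})$ and $\pi_{x_0}(\Omega_{-c})=\sum_{\omega\in\Omega_{-c}}\pi(\omega;e-x_0)$. *)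

theory Defs
  imports "HOL-Analysis.Analysis"
begin

text \<open>
  The vertex set of the graph is a finite type \<open>'c\<close>; edges are a relation on it
  (assumed symmetric and irreflexive where needed). Configurations are natural-number vectors, so
  that \<open>(\<eta>\<^sub>c \<sigma>\<^sub>c) ^ \<omega>\<^sub>c\<close> is a power with natural exponent and \<open>0 ^ 0 = 1\<close>.
\<close>

definition simple_graph :: "('c \<times> 'c) set \<Rightarrow> bool" where
  "simple_graph E \<longleftrightarrow> sym E \<and> irrefl E"

definition Omega :: "('c::finite \<times> 'c) set \<Rightarrow> (nat ^ 'c) set" where
  "Omega E = {\<omega>. (\<forall>c. \<omega> $ c \<in> {0, 1}) \<and> (\<forall>c d. (c, d) \<in> E \<longrightarrow> \<omega> $ c * \<omega> $ d = 0)}"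

definition Omega_minus :: "('c::finite \<times> 'c) set \<Rightarrow> 'c \<Rightarrow> (nat ^ 'c) set" where
  "Omega_minus E c = {\<omega> \<in> Omega E. \<omega> $ c = 0 \<and> (\<forall>d. (c, d) \<in> E \<longrightarrow> \<omega> $ d = 0)}"

definition Omega_plus :: "('c::finite \<times> 'c) set \<Rightarrow> 'c \<Rightarrow> (nat ^ 'c) set" where
  "Omega_plus E c = {\<omega> \<in> Omega E. \<omega> $ c = 1}"

definition Omega_hull :: "('c::finite \<times> 'c) set \<Rightarrow> (real ^ 'c) set" where
  "Omega_hull E = convex hull ((\<lambda>\<omega>. \<chi> c. real (\<omega> $ c)) ` Omega E)"

definition Z_weight :: "('c::finite \<Rightarrow> real) \<Rightarrow> nat ^ 'c \<Rightarrow> real ^ 'c \<Rightarrow> real" where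
  "Z_weight \<sigma> \<omega> \<eta> = (\<Prod>c\<in>UNIV. (\<eta> $ c * \<sigma> c) ^ (\<omega> $ c))"

definition stat_dist ::
  "('c::finite \<times> 'c) set \<Rightarrow> ('c \<Rightarrow> real) \<Rightarrow> nat ^ 'c \<Rightarrow> real ^ 'c \<Rightarrow> real" where
  "stat_dist E \<sigma> \<omega> \<eta> = Z_weight \<sigma> \<omega> \<eta> / (\<Sum>\<omega>'\<in>Omega E. Z_weight \<sigma> \<omega>' \<eta>)"

definition throughput ::
  "('c::finite \<times> 'c) set \<Rightarrow> ('c \<Rightarrow> real) \<Rightarrow> real ^ 'c \<Rightarrow> real ^ 'c" where
  "throughput E \<sigma> \<eta> = (\<chi> c. \<Sum>\<omega>\<in>Omega_plus E c. stat_dist E \<sigma> \<omega> \<eta>)"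

text \<open>The inverse of the throughput map; only meaningful on the interior of \<open>Omega_hull E\<close>.\<close>

definition eta_of ::
  "('c::finite \<times> 'c) set \<Rightarrow> ('c \<Rightarrow> real) \<Rightarrow> real ^ 'c \<Rightarrow> real ^ 'c" where
  "eta_of E \<sigma> \<gamma> = (THE \<eta>. (\<forall>c. 0 \<le> \<eta> $ c) \<and> throughput E \<sigma> \<eta> = \<gamma>)"

definition state_space :: "('c::finite \<Rightarrow> nat \<Rightarrow> real) set" where
  "state_space = {x. \<forall>c. (\<forall>n. 0 \<le> x c n) \<and> summable (x c) \<and> (\<Sum>n. x c n) \<le> 1}"

definition state_space1 :: "('c::finite \<Rightarrow> nat \<Rightarrow> real) set" where
  "state_space1 = {x \<in> state_space. \<forall>c. (\<Sum>n. x c n) = 1}"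

definition unit_vec :: "'c \<Rightarrow> nat \<Rightarrow> 'c \<Rightarrow> nat \<Rightarrow> real" where
  "unit_vec c n = (\<lambda>d m. if d = c \<and> m = n then 1 else 0)"

definition idle_prob ::
  "('c::finite \<times> 'c) set \<Rightarrow> ('c \<Rightarrow> real) \<Rightarrow> ('c \<Rightarrow> nat \<Rightarrow> real) \<Rightarrow> 'c \<Rightarrow> real" where
  "idle_prob E \<sigma> x c = (\<Sum>\<omega>\<in>Omega_minus E c. stat_dist E \<sigma> \<omega> (\<chi> d. 1 - x d 0))"

text \<open>
  The drift \<open>H\<close>, with the series of unit vectors taken coordinatewise: \<open>drift E p lam mu nu x d m\<close>
  is the \<open>(d, m)\<close> coordinate. Every coordinate series has only finitely many nonzero terms.
\<close>

definition drift ::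
  "('c::finite \<times> 'c) set \<Rightarrow> ('c \<Rightarrow> real) \<Rightarrow> ('c \<Rightarrow> real) \<Rightarrow> ('c \<Rightarrow> real) \<Rightarrow> ('c \<Rightarrow> real)
    \<Rightarrow> ('c \<Rightarrow> nat \<Rightarrow> real) \<Rightarrow> ('c \<Rightarrow> nat \<Rightarrow> real)" where
  "drift E p lam mu nu x = (\<lambda>d m.
     \<Sum>c\<in>UNIV. 1 / p c *
       (lam c * (\<Sum>\<^sub>\<infinity>n\<in>{0..}. x c n * (unit_vec c (n + 1) d m - unit_vec c n d m))
        + idle_prob E (\<lambda>d. nu d / mu d) x c * nu c *
          (\<Sum>\<^sub>\<infinity>n\<in>{1..}. x c n * (unit_vec c (n - 1) d m - unit_vec c n d m))))"

end

theory Submission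
  imports Defs
begin

text \<open>
  Exponential tilting: with \<open>\<eta> = exp s\<close> the equation \<open>throughput \<eta> = \<gamma>\<close> says that \<open>s\<close> is a critical
  point of the convex function \<open>s \<mapsto> \<Sum>\<omega>. W \<omega> * exp ((\<omega> - \<gamma>) \<bullet> s)\<close>. For \<open>\<gamma>\<close> in the interior of the hull
  this function is coercive, so a critical point exists, and it is unique by strict convexity.
  A zero of the drift satisfies \<open>\<lambda>\<^sub>c x\<^sub>c\<^sub>,\<^sub>n = \<pi>(\<Omega>\<^sub>-\<^sub>c) \<nu>\<^sub>c x\<^sub>c\<^sub>,\<^sub>n\<^sub>+\<^sub>1\<close>; summing over \<open>n\<close> gives
  \<open>throughput (1 - x\<^sub>0) = \<rho>\<close>, which forces \<open>1 - x\<^sub>0 = \<xi>\<close> and the geometric form of \<open>x\<close>.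
\<close>

subsection \<open>Critical points of exponential sums\<close>

text \<open>A ball of radius \<open>e\<close> around \<gamma> lies in the hull, so the point at
  distance \<open>e\<close> from \<gamma> in direction \<open>u\<close> does too. If every generator
  stayed below the bound, the whole hull would lie in an open half-space missing that point. That
  one \<open>e\<close> serves all \<open>u\<close> yields both coercivity and strict convexity
  below.\<close>

lemma interior_hull_support:
  fixes \<gamma> :: "'a::euclidean_space"
  assumes "\<gamma> \<in> interior (convex hull A)"
  obtains e where "e > 0" "\<And>u. \<exists>a\<in>A. e * norm u \<le> (a - \<gamma>) \<bullet> u"
proof -
  obtain e where e: "e > 0" "cball \<gamma> e \<subseteq> convex hull A"
    using assms by (meson mem_interior_cball)
  have "\<exists>a\<in>A. e * norm u \<le> (a - \<gamma>) \<bullet> u" for u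
  proof (rule ccontr)
    assume contra: "\<not> ?thesis"
    have "A \<subseteq> {x. u \<bullet> x < e * norm u + \<gamma> \<bullet> u}"
      using contra by (auto simp: inner_diff_left inner_commute[of u] not_le less_diff_eq add.commute)
    then have sub: "convex hull A \<subseteq> {x. u \<bullet> x < e * norm u + \<gamma> \<bullet> u}"
      by (intro hull_minimal convex_halfspace_lt)
    have "\<gamma> + e *\<^sub>R sgn u \<in> cball \<gamma> e"
      using e(1) by (simp add: dist_norm norm_sgn)
    then have "u \<bullet> (\<gamma> + e *\<^sub>R sgn u) < e * norm u + \<gamma> \<bullet> u"
      using e(2) sub by blast
    moreover have "u \<bullet> sgn u = norm u"
      by (cases "u = 0") (simp_all add: sgn_div_norm dot_square_norm power2_eq_square)
    ultimately show False
      by (simp add: inner_add_right inner_commute)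
  qed
  then show thesis using that e(1) by blast
qed

lemma exp_sum_critical_point_exists:
  fixes v :: "'i \<Rightarrow> 'a::euclidean_space"
  assumes fin: "finite I" and w: "\<And>i. i \<in> I \<Longrightarrow> w i > 0"
    and int: "\<gamma> \<in> interior (convex hull (v ` I))"
  shows "\<exists>s. (\<Sum>i\<in>I. (w i * exp ((v i - \<gamma>) \<bullet> s)) *\<^sub>R (v i - \<gamma>)) = 0"
proof -
  define F where "F s = (\<Sum>i\<in>I. w i * exp ((v i - \<gamma>) \<bullet> s))" for s
  obtain e where e: "e > 0" "\<And>u. \<exists>a\<in>v ` I. e * norm u \<le> (a - \<gamma>) \<bullet> u"
    using interior_hull_support[OF int] by blast
  \<comment> \<open>At \<open>u = 0\<close> the bound is trivial, but it still supplies a generator,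
    so the minimum below is taken over a nonempty set.\<close>
  have ne: "I \<noteq> {}" using e(2)[of 0] by auto
  define m where "m = Min (w ` I)"
  have m: "m > 0" "\<And>i. i \<in> I \<Longrightarrow> m \<le> w i"
    using fin ne w by (auto simp: m_def)
  have coercive: "m * (e * norm s) \<le> F s" for s
  proof -
    obtain i where i: "i \<in> I" "e * norm s \<le> (v i - \<gamma>) \<bullet> s" using e(2) by blast
    have "e * norm s \<le> exp ((v i - \<gamma>) \<bullet> s)"
      using i(2) exp_ge_add_one_self[of "(v i - \<gamma>) \<bullet> s"] by linarith
    then have "m * (e * norm s) \<le> w i * exp ((v i - \<gamma>) \<bullet> s)"
      using m i(1) e(1) less_imp_le[OF w] by (intro mult_mono) auto
    also have "\<dots> \<le> F s"
      unfolding F_def using fin i(1) less_imp_le[OF w] by (intro member_le_sum) auto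
    finally show ?thesis .
  qed
  \<comment> \<open>Outside the ball of radius \<open>R\<close> the coercive bound already exceeds
    \<open>F 0\<close>, so a minimum over the compact ball is global.\<close>
  define R where "R = F 0 / (m * e)"
  have "F 0 \<ge> 0" unfolding F_def by (intro sum_nonneg) (simp add: w less_imp_le)
  then have R: "R \<ge> 0" using m e by (simp add: R_def)
  have "continuous_on (cball 0 R) F" unfolding F_def by (intro continuous_intros)
  then obtain s where s: "\<And>t. t \<in> cball 0 R \<Longrightarrow> F s \<le> F t"
    using continuous_attains_inf[of "cball 0 R" F] R by (force simp del: mem_cball)
  have min: "F s \<le> F t" for t
  proof (cases "norm t \<le> R")
    case False
    then have "F 0 \<le> m * (e * norm t)"
      using m e by (simp add: R_def field_simps)
    then show ?thesis using coercive[of t] s[of 0] R by simp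
  qed (use s in simp)
  have "(F has_derivative
      (\<lambda>h. \<Sum>i\<in>I. w i * (exp ((v i - \<gamma>) \<bullet> s) * ((v i - \<gamma>) \<bullet> h)))) (at s)"
    unfolding F_def by (auto intro!: derivative_eq_intros simp: algebra_simps)
  then have "(\<lambda>h. \<Sum>i\<in>I. w i * (exp ((v i - \<gamma>) \<bullet> s) * ((v i - \<gamma>) \<bullet> h))) = (\<lambda>h. 0)"
    by (rule has_derivative_local_min) (simp add: min)
  then have "(\<Sum>i\<in>I. (w i * exp ((v i - \<gamma>) \<bullet> s)) *\<^sub>R (v i - \<gamma>)) \<bullet> h = 0" for h
    by (simp add: inner_sum_left mult.assoc fun_eq_iff)
  then show ?thesis by (metis inner_eq_zero_iff)
qed

text \<open>The gradient is monotone: pairing the difference of the two gradients with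
  \<open>t - s\<close> gives a sum of terms \<open>w * (exp a - exp b) * (a - b)\<close>, each
  nonnegative. Since the total is 0, each term vanishes, so \<open>t - s\<close> is orthogonal to
  every \<open>v i - \<gamma>\<close>, and the support bound forces it to be 0.\<close>

lemma exp_sum_critical_point_unique:
  fixes v :: "'i \<Rightarrow> 'a::euclidean_space"
  assumes fin: "finite I" and w: "\<And>i. i \<in> I \<Longrightarrow> w i > 0"
    and int: "\<gamma> \<in> interior (convex hull (v ` I))"
    and s: "(\<Sum>i\<in>I. (w i * exp ((v i - \<gamma>) \<bullet> s)) *\<^sub>R (v i - \<gamma>)) = 0"
    and t: "(\<Sum>i\<in>I. (w i * exp ((v i - \<gamma>) \<bullet> t)) *\<^sub>R (v i - \<gamma>)) = 0"
  shows "s = t"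
proof -
  let ?d = "\<lambda>i. (exp ((v i - \<gamma>) \<bullet> t) - exp ((v i - \<gamma>) \<bullet> s)) * ((v i - \<gamma>) \<bullet> (t - s))"
  have nonneg: "w i * ?d i \<ge> 0" if "i \<in> I" for i
    using less_imp_le[OF w[OF that]]
    by (rule mult_nonneg_nonneg) (auto simp: zero_le_mult_iff inner_diff_right[of "v i - \<gamma>" t s])
  have "(\<Sum>i\<in>I. w i * ?d i)
      = (\<Sum>i\<in>I. (w i * exp ((v i - \<gamma>) \<bullet> t)) *\<^sub>R (v i - \<gamma>)) \<bullet> (t - s)
      - (\<Sum>i\<in>I. (w i * exp ((v i - \<gamma>) \<bullet> s)) *\<^sub>R (v i - \<gamma>)) \<bullet> (t - s)"
    unfolding inner_sum_left sum_subtractf[symmetric]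
    by (rule sum.cong) (auto simp: algebra_simps)
  also have "\<dots> = 0" by (simp add: s t)
  finally have "w i * ?d i = 0" if "i \<in> I" for i
    using sum_nonneg_eq_0_iff[where f = "\<lambda>i. w i * ?d i", OF fin nonneg] that by blast
  then have zero: "(v i - \<gamma>) \<bullet> (t - s) = 0" if "i \<in> I" for i
    using w[OF that] that by (force simp: inner_diff_right)
  obtain e where e: "e > 0" "\<And>u. \<exists>a\<in>v ` I. e * norm u \<le> (a - \<gamma>) \<bullet> u"
    using interior_hull_support[OF int] by blast
  have "e * norm (t - s) \<le> 0" using e(2)[of "t - s"] zero by auto
  then show ?thesis using e(1) by (simp add: mult_le_0_iff)
qed

subsection \<open>Inverting the throughput map\<close>

abbreviation real_vec :: "nat ^ 'c \<Rightarrow> real ^ 'c" where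
  "real_vec \<omega> \<equiv> \<chi> c. real (\<omega> $ c)"

text \<open>A 0/1 configuration is determined by the set of vertices where it is 1, and there are
  finitely many such sets.\<close>

lemma finite_Omega: "finite (Omega E)"
proof (rule finite_imageD)
  show "inj_on (\<lambda>\<omega>. {c. \<omega> $ c = 1}) (Omega E)"
  proof (rule inj_onI)
    fix \<omega> \<omega>' assume o: "\<omega> \<in> Omega E" "\<omega>' \<in> Omega E" "{c. \<omega> $ c = 1} = {c. \<omega>' $ c = 1}"
    have "\<omega> $ c = \<omega>' $ c" for c
    proof -
      have "\<omega> $ c \<in> {0, 1}" "\<omega>' $ c \<in> {0, 1}" "\<omega> $ c = 1 \<longleftrightarrow> \<omega>' $ c = 1"
        using o by (auto simp: Omega_def)
      then show ?thesis by auto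
    qed
    then show "\<omega> = \<omega>'" by (simp add: vec_eq_iff)
  qed
qed simp

lemma Z_weight_nonneg:
  "(\<And>c. 0 \<le> \<eta> $ c) \<Longrightarrow> (\<And>c. 0 < \<sigma> c) \<Longrightarrow> 0 \<le> Z_weight \<sigma> \<omega> \<eta>"
  unfolding Z_weight_def by (intro prod_nonneg) (simp add: less_imp_le)

lemma partition_function_pos:
  assumes "\<And>c. 0 \<le> \<eta> $ c" "\<And>c. 0 < \<sigma> c"
  shows "0 < (\<Sum>\<omega>\<in>Omega E. Z_weight \<sigma> \<omega> \<eta>)"
proof (rule sum_pos2[OF finite_Omega])
  show "0 \<in> Omega E" by (simp add: Omega_def)
  show "0 < Z_weight \<sigma> 0 \<eta>" by (simp add: Z_weight_def)
qed (rule Z_weight_nonneg[OF assms])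

text \<open>On \<open>Omega E\<close> the entry \<open>\<omega> $ c\<close> is the indicator of
  \<open>Omega_plus E c\<close>, so the throughput is the mean configuration under the stationary
  distribution.\<close>

lemma throughput_nth:
  "throughput E \<sigma> \<eta> $ c
    = (\<Sum>\<omega>\<in>Omega E. Z_weight \<sigma> \<omega> \<eta> * real (\<omega> $ c)) / (\<Sum>\<omega>\<in>Omega E. Z_weight \<sigma> \<omega> \<eta>)"
proof -
  have "(\<Sum>\<omega>\<in>Omega_plus E c. Z_weight \<sigma> \<omega> \<eta>)
      = (\<Sum>\<omega>\<in>Omega E. Z_weight \<sigma> \<omega> \<eta> * real (\<omega> $ c))"
  proof (rule sum.mono_neutral_cong_left[OF finite_Omega])
    show "\<forall>\<omega>\<in>Omega E - Omega_plus E c. Z_weight \<sigma> \<omega> \<eta> * real (\<omega> $ c) = 0"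
      by (force simp: Omega_plus_def Omega_def)
  qed (auto simp: Omega_plus_def)
  then show ?thesis
    by (simp add: throughput_def stat_dist_def flip: sum_divide_distrib)
qed

lemma throughput_eq_iff:
  assumes "\<And>c. 0 \<le> \<eta> $ c" "\<And>c. 0 < \<sigma> c"
  shows "throughput E \<sigma> \<eta> = \<gamma>
    \<longleftrightarrow> (\<Sum>\<omega>\<in>Omega E. Z_weight \<sigma> \<omega> \<eta> *\<^sub>R (real_vec \<omega> - \<gamma>)) = 0"
  using partition_function_pos[where E=E and \<eta>=\<eta> and \<sigma>=\<sigma>, OF assms]
  by (simp add: vec_eq_iff throughput_nth divide_eq_eq right_diff_distrib sum_subtractf
      mult.commute sum_distrib_left)

lemma Z_weight_exp:
  "Z_weight \<sigma> \<omega> (\<chi> c. exp (s $ c)) = Z_weight \<sigma> \<omega> 1 * exp (real_vec \<omega> \<bullet> s)"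
  by (simp add: Z_weight_def inner_vec_def exp_sum power_mult_distrib exp_of_nat_mult prod.distrib)

text \<open>Centring the exponent at \<gamma> only takes out the positive factor
  \<open>exp (\<gamma> \<bullet> s)\<close>, which turns the moment equation into the critical point
  equation.\<close>

lemma throughput_exp_eq_iff:
  assumes "\<And>c. 0 < \<sigma> c"
  shows "throughput E \<sigma> (\<chi> c. exp (s $ c)) = \<gamma>
    \<longleftrightarrow> (\<Sum>\<omega>\<in>Omega E. (Z_weight \<sigma> \<omega> 1 * exp ((real_vec \<omega> - \<gamma>) \<bullet> s)) *\<^sub>R (real_vec \<omega> - \<gamma>)) = 0"
proof -
  have "(\<Sum>\<omega>\<in>Omega E. Z_weight \<sigma> \<omega> (\<chi> c. exp (s $ c)) *\<^sub>R (real_vec \<omega> - \<gamma>))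
      = exp (\<gamma> \<bullet> s) *\<^sub>R
        (\<Sum>\<omega>\<in>Omega E. (Z_weight \<sigma> \<omega> 1 * exp ((real_vec \<omega> - \<gamma>) \<bullet> s)) *\<^sub>R (real_vec \<omega> - \<gamma>))"
    unfolding scaleR_sum_right
    by (intro sum.cong) (simp_all add: Z_weight_exp inner_diff_left exp_diff)
  then show ?thesis
    by (subst throughput_eq_iff) (simp_all add: assms)
qed

text \<open>If \<open>\<eta> $ c = 0\<close>, every configuration occupying \<open>c\<close> has
  weight 0. This rules out boundary solutions, which the parametrization by \<open>exp\<close>
  cannot reach.\<close>

lemma throughput_pos_imp_pos:
  assumes "0 < throughput E \<sigma> \<eta> $ c" "0 \<le> \<eta> $ c"
  shows "0 < \<eta> $ c"
proof (rule ccontr)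
  assume "\<not> 0 < \<eta> $ c"
  then have "\<eta> $ c = 0" using assms(2) by simp
  then have zero: "Z_weight \<sigma> \<omega> \<eta> * real (\<omega> $ c) = 0" for \<omega>
    unfolding Z_weight_def by (cases "\<omega> $ c = 0") (auto intro!: prod_zero bexI[of _ c])
  have "throughput E \<sigma> \<eta> $ c = 0"
    by (simp only: throughput_nth zero sum.neutral_const div_0)
  then show False using assms(1) by simp
qed

text \<open>Justifies the \<open>THE\<close> in \<open>eta_of\<close>: solutions have positive
  entries, so taking logarithms matches them with the critical points of the exponential
  sum.\<close>

lemma throughput_inverse_unique_exists:
  assumes \<sigma>: "\<And>c. 0 < \<sigma> c" and \<gamma>: "\<And>c. 0 < \<gamma> $ c" and int: "\<gamma> \<in> interior (Omega_hull E)"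
  shows "\<exists>!\<eta>. (\<forall>c. 0 \<le> \<eta> $ c) \<and> throughput E \<sigma> \<eta> = \<gamma>"
proof -
  have W: "0 < Z_weight \<sigma> \<omega> 1" for \<omega>
    unfolding Z_weight_def using \<sigma> by (intro prod_pos) simp
  note crit_exists = exp_sum_critical_point_exists[where v = real_vec
      and w = "\<lambda>\<omega>. Z_weight \<sigma> \<omega> 1", OF finite_Omega W int[unfolded Omega_hull_def]]
  note crit_unique = exp_sum_critical_point_unique[where v = real_vec
      and w = "\<lambda>\<omega>. Z_weight \<sigma> \<omega> 1", OF finite_Omega W int[unfolded Omega_hull_def]]
  obtain s where s: "throughput E \<sigma> (\<chi> c. exp (s $ c)) = \<gamma>"
    using crit_exists
    unfolding throughput_exp_eq_iff[where \<sigma>=\<sigma>, OF \<sigma>] by blast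
  show ?thesis
  proof (rule ex1I)
    show "(\<forall>c. 0 \<le> (\<chi> c. exp (s $ c)) $ c) \<and> throughput E \<sigma> (\<chi> c. exp (s $ c)) = \<gamma>"
      by (simp add: s)
  next
    fix \<eta> assume \<eta>: "(\<forall>c. 0 \<le> \<eta> $ c) \<and> throughput E \<sigma> \<eta> = \<gamma>"
    define t where "t = (\<chi> c. ln (\<eta> $ c))"
    have "0 < \<eta> $ c" for c using \<eta> \<gamma> throughput_pos_imp_pos by metis
    then have \<eta>t: "\<eta> = (\<chi> c. exp (t $ c))" by (simp add: t_def vec_eq_iff)
    then have "t = s"
      using \<eta> s crit_unique
      unfolding \<eta>t throughput_exp_eq_iff[where \<sigma>=\<sigma>, OF \<sigma>] by blast
    then show "\<eta> = (\<chi> c. exp (s $ c))" using \<eta>t by simp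
  qed
qed

subsection \<open>Zeros of the drift\<close>

text \<open>Occupying \<open>c\<close> maps \<open>\<Omega>\<^sub>-\<^sub>c\<close> bijectively onto \<open>\<Omega>\<^sub>+\<^sub>c\<close> and multiplies the weight by \<open>\<eta>\<^sub>c \<sigma>\<^sub>c\<close>.\<close>

lemma throughput_eq_idle:
  assumes "simple_graph E"
  shows "throughput E \<sigma> \<eta> $ c = \<eta> $ c * \<sigma> c * (\<Sum>\<omega>\<in>Omega_minus E c. stat_dist E \<sigma> \<omega> \<eta>)"
proof -
  let ?up = "\<lambda>k \<omega>. (\<chi> d. if d = c then k else \<omega> $ d) :: nat ^ _"
  have E: "\<And>a b. (a, b) \<in> E \<Longrightarrow> (b, a) \<in> E" "\<And>a. (a, a) \<notin> E"
    using assms by (auto simp: simple_graph_def sym_def irrefl_def)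
  have "(\<Sum>\<omega>\<in>Omega_plus E c. Z_weight \<sigma> \<omega> \<eta>)
      = (\<Sum>\<omega>\<in>Omega_minus E c. \<eta> $ c * \<sigma> c * Z_weight \<sigma> \<omega> \<eta>)"
  proof (rule sum.reindex_bij_witness[where i = "?up 1" and j = "?up 0"])
    fix \<omega> assume "\<omega> \<in> Omega_plus E c"
    then have \<omega>: "\<omega> $ c = 1" "\<And>d. \<omega> $ d \<in> {0, 1}" "\<And>a b. (a, b) \<in> E \<Longrightarrow> \<omega> $ a * \<omega> $ b = 0"
      unfolding Omega_plus_def Omega_def by blast+
    show "?up 1 (?up 0 \<omega>) = \<omega>" using \<omega>(1) by (simp add: vec_eq_iff)
    have "\<omega> $ d = 0" if "(c, d) \<in> E" for d using \<omega>(3)[OF that] \<omega>(1) by simp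
    then show "?up 0 \<omega> \<in> Omega_minus E c"
      using \<omega>(2,3) unfolding Omega_minus_def Omega_def by simp
    have "Z_weight \<sigma> \<omega> \<eta> = \<eta> $ c * \<sigma> c * (\<Prod>d\<in>UNIV - {c}. (\<eta> $ d * \<sigma> d) ^ (\<omega> $ d))"
      unfolding Z_weight_def by (subst prod.remove[of _ c]) (simp_all add: \<omega>(1))
    moreover have "Z_weight \<sigma> (?up 0 \<omega>) \<eta> = (\<Prod>d\<in>UNIV - {c}. (\<eta> $ d * \<sigma> d) ^ (\<omega> $ d))"
      unfolding Z_weight_def by (subst prod.remove[of _ c]) (auto intro!: prod.cong)
    ultimately show "\<eta> $ c * \<sigma> c * Z_weight \<sigma> (?up 0 \<omega>) \<eta> = Z_weight \<sigma> \<omega> \<eta>"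
      by simp
  next
    fix \<omega> assume "\<omega> \<in> Omega_minus E c"
    then have \<omega>: "\<omega> $ c = 0" "\<And>d. \<omega> $ d \<in> {0, 1}" "\<And>a b. (a, b) \<in> E \<Longrightarrow> \<omega> $ a * \<omega> $ b = 0"
      "\<And>d. (c, d) \<in> E \<Longrightarrow> \<omega> $ d = 0"
      unfolding Omega_minus_def Omega_def by blast+
    show "?up 0 (?up 1 \<omega>) = \<omega>" using \<omega>(1) by (simp add: vec_eq_iff)
    \<comment> \<open>Symmetry of \<open>E\<close> covers edges that end in \<open>c\<close>;
      irreflexivity excludes a loop at \<open>c\<close>, where the product would be 1.\<close>
    show "?up 1 \<omega> \<in> Omega_plus E c"
      using \<omega>(2,3,4) E unfolding Omega_plus_def Omega_def by auto
  qed
  then show ?thesis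
    by (simp add: throughput_def stat_dist_def sum_distrib_left flip: sum_divide_distrib)
qed

lemma infsum_births:
  "(\<Sum>\<^sub>\<infinity>n\<in>{0..}. x n * (unit_vec c (n + 1) d m - unit_vec c n d m))
    = (if c = d then (if m = 0 then 0 else x (m - 1)) - x m else (0::real))"
proof -
  have "(\<Sum>\<^sub>\<infinity>n\<in>{0..}. x n * (unit_vec c (n + 1) d m - unit_vec c n d m))
      = (\<Sum>\<^sub>\<infinity>n\<in>{m - 1, m}. x n * (unit_vec c (n + 1) d m - unit_vec c n d m))"
    by (rule infsum_cong_neutral) (auto simp: unit_vec_def)
  also have "\<dots> = (if c = d then (if m = 0 then 0 else x (m - 1)) - x m else 0)"
    by (cases m) (auto simp: unit_vec_def)
  finally show ?thesis .
qed

lemma infsum_deaths: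
  "(\<Sum>\<^sub>\<infinity>n\<in>{1..}. x n * (unit_vec c (n - 1) d m - unit_vec c n d m))
    = (if c = d then x (Suc m) - (if m = 0 then 0 else x m) else (0::real))"
proof -
  have "(\<Sum>\<^sub>\<infinity>n\<in>{1..}. x n * (unit_vec c (n - 1) d m - unit_vec c n d m))
      = (\<Sum>\<^sub>\<infinity>n\<in>{Suc m} \<union> ({m} - {0}). x n * (unit_vec c (n - 1) d m - unit_vec c n d m))"
    by (rule infsum_cong_neutral) (auto simp: unit_vec_def)
  also have "\<dots> = (if c = d then x (Suc m) - (if m = 0 then 0 else x m) else 0)"
    by (cases m) (auto simp: unit_vec_def)
  finally show ?thesis .
qed

lemma drift_nth:
  "drift E p lam mu nu x d m = 1 / p d *
    (lam d * ((if m = 0 then 0 else x d (m - 1)) - x d m)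
     + idle_prob E (\<lambda>d. nu d / mu d) x d * nu d * (x d (Suc m) - (if m = 0 then 0 else x d m)))"
proof -
  have "drift E p lam mu nu x d m = (\<Sum>c\<in>UNIV. if c = d then 1 / p c *
    (lam c * ((if m = 0 then 0 else x c (m - 1)) - x c m)
     + idle_prob E (\<lambda>d. nu d / mu d) x c * nu c * (x c (Suc m) - (if m = 0 then 0 else x c m)))
    else 0)"
    unfolding drift_def infsum_births infsum_deaths by (rule sum.cong) auto
  then show ?thesis by simp
qed

text \<open>Each drift coordinate is, up to \<open>1 / p c\<close>, the net flow across the cut
  below \<open>n\<close> minus that across the cut above it. There is no flow below 0, so by
  induction all net flows vanish.\<close>

lemma drift_zero_iff_balance:
  assumes "\<And>c. p c > 0"
  shows "drift E p lam mu nu x = (\<lambda>c n. 0) \<longleftrightarrow>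
    (\<forall>c n. lam c * x c n = idle_prob E (\<lambda>d. nu d / mu d) x c * nu c * x c (Suc n))"
    (is "?L \<longleftrightarrow> ?R")
proof
  assume ?L
  then have D0: "drift E p lam mu nu x c n = 0" for c n by simp
  have D: "lam c * ((if n = 0 then 0 else x c (n - 1)) - x c n)
     + idle_prob E (\<lambda>d. nu d / mu d) x c * nu c * (x c (Suc n) - (if n = 0 then 0 else x c n)) = 0"
    for c n
    using D0[of c n] assms[of c] unfolding drift_nth by simp
  show ?R
  proof (intro allI)
    fix c n
    show "lam c * x c n = idle_prob E (\<lambda>d. nu d / mu d) x c * nu c * x c (Suc n)"
    proof (induction n)
      case 0
      show ?case using D[of c 0] by simp
    next
      case (Suc n)
      then show ?case using D[of c "Suc n"] by (simp add: algebra_simps)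
    qed
  qed
next
  assume R: ?R
  show ?L
  proof (intro ext)
    fix c n
    show "drift E p lam mu nu x c n = 0"
      using R[rule_format, of c n] R[rule_format, of c "n - 1"] unfolding drift_nth
      by (cases n) (simp_all add: right_diff_distrib)
  qed
qed

text \<open>Summing over \<open>n\<close>, the left side has total mass 1 and the shifted right side
  has mass \<open>1 - x c 0\<close>. This leaves an equation in the empty-queue fractions alone,
  which \<open>throughput_eq_idle\<close> identifies as a throughput equation.\<close>

lemma balance_imp_throughput:
  assumes "simple_graph E" "x \<in> state_space1" "mu c > 0"
    and bal: "\<And>n. lam c * x c n = idle_prob E (\<lambda>d. nu d / mu d) x c * nu c * x c (Suc n)"
  shows "throughput E (\<lambda>d. nu d / mu d) (\<chi> d. 1 - x d 0) $ c = lam c / mu c"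
proof -
  have x: "summable (x c)" "suminf (x c) = 1"
    using assms(2) by (auto simp: state_space1_def state_space_def)
  have "lam c = (\<Sum>n. lam c * x c n)" using x by (simp add: suminf_mult)
  also have "\<dots> = (\<Sum>n. idle_prob E (\<lambda>d. nu d / mu d) x c * nu c * x c (Suc n))"
    by (simp add: bal)
  also have "\<dots> = idle_prob E (\<lambda>d. nu d / mu d) x c * nu c * (1 - x c 0)"
    using x by (subst suminf_mult) (auto simp: summable_Suc_iff suminf_split_head)
  finally show ?thesis
    using throughput_eq_idle[OF assms(1), of "\<lambda>d. nu d / mu d" "\<chi> d. 1 - x d 0" c]
    by (simp add: idle_prob_def mult_ac)
qed

lemma geometric_in_state_space1:
  fixes \<xi> :: "real ^ 'c"
  assumes "\<And>c. 0 \<le> \<xi> $ c" "\<And>c. \<xi> $ c < 1"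
  shows "(\<lambda>c n. (1 - \<xi> $ c) * (\<xi> $ c) ^ n) \<in> state_space1"
proof -
  have sums: "(\<lambda>n. (1 - \<xi> $ c) * (\<xi> $ c) ^ n) sums ((1 - \<xi> $ c) * (1 / (1 - \<xi> $ c)))" for c
    using assms by (intro sums_mult geometric_sums) simp
  have "(\<lambda>n. (1 - \<xi> $ c) * (\<xi> $ c) ^ n) sums 1" for c
    using sums[of c] assms(2)[of c] by simp
  then show ?thesis
    using assms less_imp_le[OF assms(2)]
    by (simp add: state_space1_def state_space_def sums_iff)
qed

theorem theorem3p2:
  fixes E :: "('c::finite \<times> 'c) set"
    and lam mu nu p :: "'c \<Rightarrow> real"
    and \<sigma> :: "'c \<Rightarrow> real"
    and \<rho> \<xi> :: "real ^ 'c"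
    and xstar :: "'c \<Rightarrow> nat \<Rightarrow> real"
  assumes "simple_graph E"
    and "\<And>c. lam c > 0" and "\<And>c. mu c > 0" and "\<And>c. nu c > 0" and "\<And>c. p c > 0"
    and "(\<Sum>c\<in>UNIV. p c) = 1"
    and "\<sigma> = (\<lambda>c. nu c / mu c)"
    and "\<rho> = (\<chi> c. lam c / mu c)"
    and "\<rho> \<in> interior (Omega_hull E)"
    and "\<xi> = eta_of E \<sigma> \<rho>"
    and "\<And>c. \<xi> $ c < 1"
    and "xstar = (\<lambda>c n. (1 - \<xi> $ c) * (\<xi> $ c) ^ n)"
  shows "xstar \<in> state_space1
    \<and> drift E p lam mu nu xstar = (\<lambda>c n. 0)
    \<and> (\<forall>x \<in> state_space1. drift E p lam mu nu x = (\<lambda>c n. 0) \<longrightarrow> x = xstar)"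
proof -
  note E = assms(1) and \<sigma>_eq = assms(7)
  have \<sigma>: "\<sigma> c > 0" for c using assms(3,4) by (simp add: \<sigma>_eq)
  have \<rho>: "\<rho> $ c = lam c / mu c" "\<rho> $ c > 0" for c using assms(2,3) by (simp_all add: assms(8))
  note ex1 = throughput_inverse_unique_exists[where \<sigma>=\<sigma>, OF \<sigma> \<rho>(2) assms(9)]
  have \<xi>: "\<And>c. 0 \<le> \<xi> $ c" "throughput E \<sigma> \<xi> = \<rho>"
    using theI'[OF ex1] by (simp_all add: assms(10) eta_of_def)
  \<comment> \<open>\<open>idle_prob\<close> sees \<open>x\<close> only through its entries at 0, so
    this one identity serves both \<open>xstar\<close> and an arbitrary zero of the drift.\<close>
  have rate: "lam c = idle_prob E \<sigma> x c * nu c * \<xi> $ c" if "\<And>d. x d 0 = 1 - \<xi> $ d" for x c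
  proof -
    have "lam c / mu c = \<xi> $ c * (nu c / mu c) * idle_prob E \<sigma> x c"
      using throughput_eq_idle[OF E, of \<sigma> \<xi> c] \<xi>(2) \<rho>(1)[of c]
      by (simp add: idle_prob_def that \<sigma>_eq)
    then show ?thesis using assms(3)[of c] by (simp add: field_simps)
  qed
  have "xstar \<in> state_space1"
    using geometric_in_state_space1[OF \<xi>(1) assms(11)] by (simp add: assms(12))
  moreover have "drift E p lam mu nu xstar = (\<lambda>c n. 0)"
    using rate[of xstar]
    by (subst drift_zero_iff_balance[OF assms(5)]) (simp add: assms(12) \<sigma>_eq)
  moreover have "x = xstar" if x: "x \<in> state_space1" and "drift E p lam mu nu x = (\<lambda>c n. 0)" for x
  proof -
    have bal: "lam c * x c n = idle_prob E \<sigma> x c * nu c * x c (Suc n)" for c n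
      using that(2) unfolding drift_zero_iff_balance[OF assms(5)] \<sigma>_eq by blast
    \<comment> \<open>This makes \<open>1 - x c 0\<close> nonnegative, placing it in the domain
      where the throughput map has a unique inverse.\<close>
    have "x c 0 \<le> 1" for c
    proof -
      have "sum (x c) {0} \<le> suminf (x c)"
        using x by (intro sum_le_suminf) (auto simp: state_space1_def state_space_def)
      then show ?thesis using x by (simp add: state_space1_def)
    qed
    moreover have "throughput E \<sigma> (\<chi> d. 1 - x d 0) = \<rho>"
      using balance_imp_throughput[where lam=lam, OF E x assms(3) bal[unfolded \<sigma>_eq]]
      by (simp add: vec_eq_iff \<rho>(1) \<sigma>_eq)
    ultimately have "(\<forall>c. 0 \<le> (\<chi> d. 1 - x d 0) $ c) \<and> throughput E \<sigma> (\<chi> d. 1 - x d 0) = \<rho>"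
      by simp
    then have "(\<chi> d. 1 - x d 0) = \<xi>" using ex1 \<xi> by blast
    then have x0: "x d 0 = 1 - \<xi> $ d" for d by (auto simp: vec_eq_iff algebra_simps)
    have "x c (Suc n) = \<xi> $ c * x c n" for c n
    proof -
      \<comment> \<open>The factor is nonzero because its product with \<open>\<xi> $ c\<close> is
        \<open>lam c > 0\<close>; cancelling it gives the geometric recursion.\<close>
      have "idle_prob E \<sigma> x c * nu c \<noteq> 0" using rate[of x c, OF x0] assms(2)[of c] by auto
      moreover have "idle_prob E \<sigma> x c * nu c * (\<xi> $ c * x c n)
          = idle_prob E \<sigma> x c * nu c * x c (Suc n)"
        using bal[of c n] rate[of x c, OF x0] by simp
      ultimately show ?thesis by simp
    qed
    then have "x c n = (1 - \<xi> $ c) * (\<xi> $ c) ^ n" for c n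
      by (induction n) (simp_all add: x0)
    then show "x = xstar" by (simp add: assms(12) fun_eq_iff)
  qed
  ultimately show ?thesis by blast
qed

end
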